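(* Let $K$ be a field of characteristic $0$, let $p\ge 1$ be an integer and $m=2p+1$. Let $L: K^m\to\operatorname{Hom}(\bigwedge^p K^m,\bigwedge^{p+1}K^m)$ be the linear map $v\mapsto (x\mapsto v\wedge x)$, and let $$\psi_L: K^m\otimes K^m\otimes K^m\to \operatorname{Mat}_{\binom{2p+1}{p}m,\binom{2p+1}{p}m}(K),\qquad \sum_i s_i\otimes X_i\mapsto \sum_i L(s_i)\otimes X_i ,$$ where $s_i\in K^m$ and $X_i\in K^m\otimes K^m=\operatorname{Mat}_{m,m}(K)$. Let $D=\binom{2p}{p}(2m-4)$. Then at least one of the $(D+1)\times(D+1)$ minors of $\psi_L$ gives a non-trivial equation for tensors in $K^m\otimes K^m\otimes K^m$ of border rank $\le 2m-4$; that is, every $(D+1)\times (D+1)$ minor of $\psi_L(T)$, regarded as a polynomial function of $T\in K^m\otimes K^m\otimes K^m$, vanishes on all tensors of border rank $\le 2m-4$, and at least one of these minors is not identically zero.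
   Context: Bases are chosen so that $\operatorname{Hom}(\bigwedge^p K^m,\bigwedge^{p+1}K^m)=\operatorname{Mat}_{N,N}(K)$ with $N=\binom{2p+1}{p}$, and $\operatorname{Mat}_{N,N}(K)\otimes\operatorname{Mat}_{m,m}(K)$ is identified with $\operatorname{Mat}_{Nm,Nm}(K)$ via the Kronecker product. The tensor rank of a tensor is the smallest $r$ such that it is a sum of $r$ pure tensors. Let $Z_r$ be the set of tensors of tensor rank $\le r$ and $\overline{Z_r}$ its Zariski closure; the border rank of $T$ is the smallest $r$ with $T\in\overline{Z_r}$. *)

theory Defs
  imports
    "Jordan_Normal_Form.Matrix"
    "Jordan_Normal_Form.Determinant"
    "Jordan_Normal_Form.DL_Submatrix"
begin

section \<open>Tensors, tensor rank and border rank\<close>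

text \<open>A tensor in \<open>K\<^sup>m \<otimes> K\<^sup>m \<otimes> K\<^sup>m\<close> is given by its coordinates in the standard basis,
  extended by zero outside \<open>{0..<m}\<^sup>3\<close> so that equality of tensors is equality of functions.\<close>

type_synonym 'a tensor3 = "nat \<Rightarrow> nat \<Rightarrow> nat \<Rightarrow> 'a"

definition tensor_space :: "nat \<Rightarrow> 'a::zero tensor3 set" where
  "tensor_space m = {T. \<forall>i j k. \<not> (i < m \<and> j < m \<and> k < m) \<longrightarrow> T i j k = 0}"

definition tensor_prod :: "'a::semiring_0 vec \<Rightarrow> 'a vec \<Rightarrow> 'a vec \<Rightarrow> 'a tensor3" where
  "tensor_prod u v w = (\<lambda>i j k. if i < dim_vec u \<and> j < dim_vec v \<and> k < dim_vec w
                                 then u $ i * v $ j * w $ k else 0)"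

definition pure_tensors :: "nat \<Rightarrow> 'a::semiring_0 tensor3 set" where
  "pure_tensors m = {tensor_prod u v w | u v w.
     u \<in> carrier_vec m \<and> v \<in> carrier_vec m \<and> w \<in> carrier_vec m}"

definition tensor_rank :: "nat \<Rightarrow> 'a::semiring_0 tensor3 \<Rightarrow> nat" where
  "tensor_rank m T = (LEAST r. \<exists>P. (\<forall>l<r. P l \<in> pure_tensors m) \<and>
                                   T = (\<lambda>i j k. \<Sum>l<r. P l i j k))"

definition rank_le_tensors :: "nat \<Rightarrow> nat \<Rightarrow> 'a::semiring_0 tensor3 set" where
  "rank_le_tensors m r = {T \<in> tensor_space m. tensor_rank m T \<le> r}"

inductive_set polynomial_functions :: "nat \<Rightarrow> ('a::comm_ring_1 tensor3 \<Rightarrow> 'a) set" for m where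
  const: "(\<lambda>T. c) \<in> polynomial_functions m"
| coord: "i < m \<Longrightarrow> j < m \<Longrightarrow> k < m \<Longrightarrow> (\<lambda>T. T i j k) \<in> polynomial_functions m"
| add: "f \<in> polynomial_functions m \<Longrightarrow> g \<in> polynomial_functions m \<Longrightarrow>
          (\<lambda>T. f T + g T) \<in> polynomial_functions m"
| mult: "f \<in> polynomial_functions m \<Longrightarrow> g \<in> polynomial_functions m \<Longrightarrow>
          (\<lambda>T. f T * g T) \<in> polynomial_functions m"

definition zariski_closed :: "nat \<Rightarrow> 'a::comm_ring_1 tensor3 set \<Rightarrow> bool" where
  "zariski_closed m C \<longleftrightarrow>
     (\<exists>F \<subseteq> polynomial_functions m. C = {T \<in> tensor_space m. \<forall>f\<in>F. f T = 0})"

definition zariski_closure :: "nat \<Rightarrow> 'a::comm_ring_1 tensor3 set \<Rightarrow> 'a tensor3 set" where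
  "zariski_closure m S = \<Inter> {C. zariski_closed m C \<and> S \<subseteq> C}"

definition border_rank :: "nat \<Rightarrow> 'a::comm_ring_1 tensor3 \<Rightarrow> nat" where
  "border_rank m T = (LEAST r. T \<in> zariski_closure m (rank_le_tensors m r))"

section \<open>The exterior algebra\<close>

text \<open>An element of the exterior algebra of \<open>K\<^sup>m\<close> is given by its coordinates in the standard basis:
  \<open>ext_basis {s\<^sub>1 < \<dots> < s\<^sub>p}\<close> stands for \<open>e\<^bsub>s\<^sub>1\<^esub> \<and> \<dots> \<and> e\<^bsub>s\<^sub>p\<^esub>\<close>.\<close>

definition ext_basis :: "nat set \<Rightarrow> nat set \<Rightarrow> 'a::zero_neq_one" where
  "ext_basis R = (\<lambda>S. if S = R then 1 else 0)"

definition inversions :: "nat set \<Rightarrow> nat set \<Rightarrow> (nat \<times> nat) set" where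
  "inversions A B = {(a, b). a \<in> A \<and> b \<in> B \<and> b < a}"

text \<open>The bilinear product determined by \<open>e\<^sub>A \<and> e\<^sub>B = \<plusminus> e\<^bsub>A \<union> B\<^esub>\<close> for disjoint \<open>A\<close> and \<open>B\<close>, the sign
  being that of the permutation sorting the concatenation of \<open>A\<close> and \<open>B\<close>, and
  \<open>e\<^sub>A \<and> e\<^sub>B = 0\<close> otherwise; see \<open>wedge_ext_basis\<close> below.\<close>

definition wedge :: "(nat set \<Rightarrow> 'a::comm_ring_1) \<Rightarrow> (nat set \<Rightarrow> 'a) \<Rightarrow> nat set \<Rightarrow> 'a" where
  "wedge x y = (\<lambda>S. \<Sum>A\<in>Pow S. (- 1) ^ card (inversions A (S - A)) * x A * y (S - A))"

definition ext_of_vec :: "'a::comm_ring_1 vec \<Rightarrow> nat set \<Rightarrow> 'a" where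
  "ext_of_vec v = (\<lambda>S. \<Sum>i<dim_vec v. v $ i * ext_basis {i} S)"

text \<open>The \<open>p\<close>-subsets of \<open>{0..<m}\<close> in lexicographic order.\<close>

definition subset_list :: "nat \<Rightarrow> nat \<Rightarrow> nat set list" where
  "subset_list m p = map set (filter (\<lambda>xs. length xs = p) (subseqs [0..<m]))"

text \<open>The matrix of a linear map from the \<open>p\<close>-th to the \<open>q\<close>-th exterior power of \<open>K\<^sup>m\<close>.\<close>

definition ext_matrix ::
  "nat \<Rightarrow> nat \<Rightarrow> nat \<Rightarrow> ((nat set \<Rightarrow> 'a::zero_neq_one) \<Rightarrow> nat set \<Rightarrow> 'a) \<Rightarrow> 'a mat" where
  "ext_matrix m p q f = mat (m choose q) (m choose p)
     (\<lambda>(a, b). f (ext_basis (subset_list m p ! b)) (subset_list m q ! a))"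

definition wedge_map :: "nat \<Rightarrow> nat \<Rightarrow> 'a::comm_ring_1 vec \<Rightarrow> 'a mat" where
  "wedge_map m p v = ext_matrix m p (Suc p) (\<lambda>x. wedge (ext_of_vec v) x)"

section \<open>The flattening\<close>

definition kronecker :: "'a::semiring_0 mat \<Rightarrow> 'a mat \<Rightarrow> 'a mat" where
  "kronecker A B = mat (dim_row A * dim_row B) (dim_col A * dim_col B)
     (\<lambda>(i, j). A $$ (i div dim_row B, j div dim_col B) * B $$ (i mod dim_row B, j mod dim_col B))"

text \<open>\<open>T = \<Sum>\<^sub>i e\<^sub>i \<otimes> T\<^sub>i\<close> with \<open>T\<^sub>i = slice m T i\<close>. That \<open>psi_L\<close> below takes the prescribed value on every
  sum of tensors \<open>s \<otimes> X\<close> is lemma \<open>psi_L_sum\<close>.\<close>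

definition slice :: "nat \<Rightarrow> 'a tensor3 \<Rightarrow> nat \<Rightarrow> 'a mat" where
  "slice m T i = mat m m (\<lambda>(j, k). T i j k)"

definition psi_L :: "nat \<Rightarrow> nat \<Rightarrow> 'a::comm_ring_1 tensor3 \<Rightarrow> 'a mat" where
  "psi_L m p T = mat ((m choose Suc p) * m) ((m choose p) * m)
     (\<lambda>(a, b). \<Sum>i<m. kronecker (wedge_map m p (unit_vec m i)) (slice m T i) $$ (a, b))"

definition minor :: "'a::comm_ring_1 mat \<Rightarrow> nat set \<Rightarrow> nat set \<Rightarrow> 'a" where
  "minor A I J = det (submatrix A I J)"

section \<open>Consistency of the encodings\<close>

lemma subset_list:
  shows "distinct (subset_list m p)"
    and "set (subset_list m p) = {S. S \<subseteq> {..<m} \<and> card S = p}"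
    and "length (subset_list m p) = m choose p"
proof -
  have d: "distinct (map set (subseqs [0..<m]))"
    by (rule distinct_set_subseqs) simp
  show dist: "distinct (subset_list m p)"
    unfolding subset_list_def using d by (simp add: distinct_map inj_on_def)
  have c: "card (set xs) = length xs" if "xs \<in> set (subseqs [0..<m])" for xs
    using subseqs_distinctD[OF that] distinct_card by fastforce
  have P: "set ` set (subseqs [0..<m]) = Pow {..<m}"
    using subseqs_powset[of "[0..<m]"] by (simp add: atLeast_upt)
  have "set (subset_list m p) = {S \<in> set ` set (subseqs [0..<m]). card S = p}"
    unfolding subset_list_def by (auto simp: c)
  then show s: "set (subset_list m p) = {S. S \<subseteq> {..<m} \<and> card S = p}"
    unfolding P by auto
  show "length (subset_list m p) = m choose p"
    using distinct_card[OF dist] n_subsets[of "{..<m}" p] s by simp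
qed

lemma wedge_ext_basis:
  assumes "finite A" and "finite B"
  shows "wedge (ext_basis A) (ext_basis B) S =
    (if A \<inter> B = {} then (- 1) ^ card (inversions A B) * ext_basis (A \<union> B) S
     else (0 :: 'a::comm_ring_1))"
proof (cases "finite S")
  case False
  then show ?thesis using assms by (auto simp: wedge_def ext_basis_def)
next
  case True
  have "wedge (ext_basis A) (ext_basis B) S =
    (\<Sum>R\<in>Pow S. if R = A then (- 1) ^ card (inversions A (S - A)) * ext_basis B (S - A) else (0::'a))"
    unfolding wedge_def by (rule sum.cong) (auto simp: ext_basis_def)
  also have "\<dots> = (if A \<subseteq> S then (- 1) ^ card (inversions A (S - A)) * ext_basis B (S - A) else 0)"
    using True by (simp add: sum.delta)
  also have "\<dots> = (if A \<inter> B = {} then (- 1) ^ card (inversions A B) * ext_basis (A \<union> B) S else 0)"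
  proof (cases "A \<subseteq> S \<and> S - A = B")
    case True
    then have "A \<inter> B = {}" "S = A \<union> B" by auto
    then show ?thesis using True by (simp add: ext_basis_def)
  next
    case False
    then have "\<not> (A \<inter> B = {} \<and> S = A \<union> B)" by auto
    then show ?thesis using False by (auto simp: ext_basis_def)
  qed
  finally show ?thesis .
qed

lemma wedge_map_mult_vec:
  assumes x: "\<And>S. x S \<noteq> 0 \<Longrightarrow> S \<subseteq> {..<m} \<and> card S = p" and v: "v \<in> carrier_vec m"
    and a: "a < m choose Suc p"
  shows "(wedge_map m p v *\<^sub>v vec (m choose p) (\<lambda>b. x (subset_list m p ! b))) $ a =
    wedge (ext_of_vec v) x (subset_list m (Suc p) ! a)"
proof -
  let ?S = "subset_list m (Suc p) ! a"
  let ?c = "\<lambda>A. (- 1) ^ card (inversions A (?S - A)) * ext_of_vec v A"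
  have S: "?S \<subseteq> {..<m}"
    using subset_list(2,3)[of m "Suc p"] nth_mem[of a "subset_list m (Suc p)"] a by auto
  have fin: "finite {R. R \<subseteq> {..<m} \<and> card R = p}"
    by (rule finite_subset[of _ "Pow {..<m}"]) auto
  have expand: "x R = (\<Sum>Q | Q \<subseteq> {..<m} \<and> card Q = p. x Q * ext_basis Q R)" for R
  proof -
    have "(\<Sum>Q | Q \<subseteq> {..<m} \<and> card Q = p. x Q * ext_basis Q R) =
      (\<Sum>Q | Q \<subseteq> {..<m} \<and> card Q = p. if Q = R then x R else 0)"
      by (rule sum.cong) (auto simp: ext_basis_def)
    then show ?thesis using fin x[of R] by (auto simp: sum.delta)
  qed
  have "(wedge_map m p v *\<^sub>v vec (m choose p) (\<lambda>b. x (subset_list m p ! b))) $ a =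
    (\<Sum>b<m choose p. wedge (ext_of_vec v) (ext_basis (subset_list m p ! b)) ?S * x (subset_list m p ! b))"
    using a by (simp add: wedge_map_def ext_matrix_def scalar_prod_def atLeast0LessThan)
  also have "\<dots> = (\<Sum>Q | Q \<subseteq> {..<m} \<and> card Q = p. wedge (ext_of_vec v) (ext_basis Q) ?S * x Q)"
    by (rule sum.reindex_bij_betw)
      (use subset_list[of m p] bij_betw_nth[of "subset_list m p"] in auto)
  also have "\<dots> = (\<Sum>A\<in>Pow ?S. \<Sum>Q | Q \<subseteq> {..<m} \<and> card Q = p. ?c A * ext_basis Q (?S - A) * x Q)"
    unfolding wedge_def sum_distrib_right by (rule sum.swap)
  also have "\<dots> = (\<Sum>A\<in>Pow ?S. ?c A * x (?S - A))"
    by (subst expand) (simp add: sum_distrib_left ac_simps)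
  finally show ?thesis unfolding wedge_def .
qed

lemma wedge_map_unit_vec:
  assumes "v \<in> carrier_vec m" "a < m choose Suc p" "b < m choose p"
  shows "wedge_map m p v $$ (a, b) = (\<Sum>i<m. v $ i * wedge_map m p (unit_vec m i) $$ (a, b))"
proof -
  have e: "ext_of_vec v A = (\<Sum>i<m. v $ i * ext_of_vec (unit_vec m i) A)" for A
  proof -
    have "ext_of_vec (unit_vec m i) A = (ext_basis {i} A :: 'a)" if "i < m" for i
    proof -
      have "ext_of_vec (unit_vec m i) A = (\<Sum>j<m. if j = i then ext_basis {i} A else (0::'a))"
        unfolding ext_of_vec_def using that by (intro sum.cong) auto
      then show ?thesis using that by simp
    qed
    then show ?thesis using assms(1) by (auto simp: ext_of_vec_def)
  qed
  let ?R = "subset_list m p ! b" and ?S = "subset_list m (Suc p) ! a"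
  let ?t = "\<lambda>A i. (- 1) ^ card (inversions A (?S - A)) * ext_of_vec (unit_vec m i) A * ext_basis ?R (?S - A)"
  have "wedge_map m p v $$ (a, b) = (\<Sum>A\<in>Pow ?S. \<Sum>i<m. v $ i * ?t A i)"
    using assms(2,3) unfolding wedge_map_def ext_matrix_def wedge_def e
    by (simp add: sum_distrib_left sum_distrib_right ac_simps)
  also have "\<dots> = (\<Sum>i<m. \<Sum>A\<in>Pow ?S. v $ i * ?t A i)"
    by (rule sum.swap)
  also have "\<dots> = (\<Sum>i<m. v $ i * wedge_map m p (unit_vec m i) $$ (a, b))"
    using assms(2,3) unfolding wedge_map_def ext_matrix_def wedge_def
    by (simp add: sum_distrib_left)
  finally show ?thesis .
qed

lemma psi_L_sum:
  fixes T :: "'a::comm_ring_1 tensor3"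
  assumes s: "\<And>l. l < r \<Longrightarrow> s l \<in> carrier_vec m" and X: "\<And>l. l < r \<Longrightarrow> X l \<in> carrier_mat m m"
    and T: "\<And>i j k. i < m \<Longrightarrow> j < m \<Longrightarrow> k < m \<Longrightarrow> T i j k = (\<Sum>l<r. s l $ i * X l $$ (j, k))"
  shows "psi_L m p T = mat ((m choose Suc p) * m) ((m choose p) * m)
    (\<lambda>(a, b). \<Sum>l<r. kronecker (wedge_map m p (s l)) (X l) $$ (a, b))"
proof (rule eq_matI)
  fix a b
  assume "a < dim_row (mat ((m choose Suc p) * m) ((m choose p) * m)
    (\<lambda>(a, b). \<Sum>l<r. kronecker (wedge_map m p (s l)) (X l) $$ (a, b)))"
    and "b < dim_col (mat ((m choose Suc p) * m) ((m choose p) * m)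
    (\<lambda>(a, b). \<Sum>l<r. kronecker (wedge_map m p (s l)) (X l) $$ (a, b)))"
  then have ab: "a < (m choose Suc p) * m" "b < (m choose p) * m" by auto
  then have m: "0 < m" by (cases m) auto
  have lt: "a div m < m choose Suc p" "b div m < m choose p" "a mod m < m" "b mod m < m"
    using ab m by (auto simp: less_mult_imp_div_less)
  let ?W = "\<lambda>v. wedge_map m p v $$ (a div m, b div m)"
  have dims: "dim_row (wedge_map m p v) = m choose Suc p" "dim_col (wedge_map m p v) = m choose p" for v :: "'a vec"
    by (simp_all add: wedge_map_def ext_matrix_def)
  have "psi_L m p T $$ (a, b) = (\<Sum>i<m. ?W (unit_vec m i) * T i (a mod m) (b mod m))"
    using ab lt by (simp add: psi_L_def kronecker_def slice_def dims)
  also have "\<dots> = (\<Sum>i<m. \<Sum>l<r. ?W (unit_vec m i) * (s l $ i * X l $$ (a mod m, b mod m)))"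
    using lt by (auto simp: T sum_distrib_left intro!: sum.cong)
  also have "\<dots> = (\<Sum>l<r. \<Sum>i<m. ?W (unit_vec m i) * (s l $ i * X l $$ (a mod m, b mod m)))"
    by (rule sum.swap)
  also have "\<dots> = (\<Sum>l<r. ?W (s l) * X l $$ (a mod m, b mod m))"
  proof (rule sum.cong)
    fix l assume "l \<in> {..<r}"
    then show "(\<Sum>i<m. ?W (unit_vec m i) * (s l $ i * X l $$ (a mod m, b mod m))) =
        ?W (s l) * X l $$ (a mod m, b mod m)"
      by (subst wedge_map_unit_vec[OF s lt(1,2)]) (auto simp: sum_distrib_left ac_simps)
  qed simp
  also have "\<dots> = (\<Sum>l<r. kronecker (wedge_map m p (s l)) (X l) $$ (a, b))"
  proof (rule sum.cong)
    fix l assume "l \<in> {..<r}"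
    then have "X l \<in> carrier_mat m m" by (auto intro: X)
    then show "?W (s l) * X l $$ (a mod m, b mod m) = kronecker (wedge_map m p (s l)) (X l) $$ (a, b)"
      using ab by (auto simp: kronecker_def dims)
  qed simp
  finally show "psi_L m p T $$ (a, b) = mat ((m choose Suc p) * m) ((m choose p) * m)
    (\<lambda>(a, b). \<Sum>l<r. kronecker (wedge_map m p (s l)) (X l) $$ (a, b)) $$ (a, b)"
    using ab by simp
qed (auto simp: psi_L_def)

end

theory Submission
  imports Defs
begin

text \<open>
  Vanishing. For a nonzero vector \<open>v\<close> of \<open>K\<^sup>m\<close> with \<open>m = 2p + 1\<close>, the map \<open>v \<and> _\<close> on the \<open>p\<close>-th exterior power
  has rank at most \<open>2p choose p\<close>, because \<open>v \<and> v \<and> x = 0\<close> makes the columns at the subsets containing a fixed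
  position \<open>i\<close> with \<open>v i \<noteq> 0\<close> redundant (\<open>wedge_map_factors\<close>). The flattening of a sum of \<open>r\<close> pure tensors
  therefore factors through a space of dimension \<open>r * (2p choose p)\<close>, and its larger minors vanish. Minors
  are polynomial functions, so they vanish on the Zariski closure as well.

  Non-vanishing. Write \<open>\<nu>(t) = (1, t, \<dots>, t\<^bsup>m-1\<^esup>)\<close> and take
  \<open>T = \<Sum>\<^sub>i e\<^sub>i \<otimes> (\<nu>(2i) \<otimes> \<nu>(2i) + \<nu>(2i+1) \<otimes> \<nu>(2i+1))\<close>. An element of the domain of the flattening is a family
  of polynomials \<open>P\<^sub>R\<close> of degree less than \<open>m\<close>, one for each \<open>p\<close>-subset \<open>R\<close>, and the component of its image at a
  \<open>(p+1)\<close>-subset \<open>S\<close> is a combination of the \<open>m + 1\<close> vectors \<open>\<nu>(2i+e)\<close>, \<open>i \<in> S\<close>, \<open>e < 2\<close>, with coefficients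
  \<open>\<plusminus> P\<^bsub>S - {i}\<^esub>(2i+e)\<close>. Any \<open>m\<close> of these vectors are independent. So for an element of the kernel all these
  coefficients vanish as soon as one of them does for each \<open>S\<close>, and then each \<open>P\<^sub>R\<close> has \<open>m + 1\<close> roots and is zero
  (\<open>psi_L_vandermonde_kernel\<close>). With \<open>N = (2p+1) choose p\<close>, the kernel is thus cut down to zero by \<open>N\<close> linear
  conditions, and the rank is at least \<open>N m - N = 2 p N\<close>, which exceeds \<open>D = (2p choose p) (4p - 2)\<close>
  (\<open>codimension_bound\<close>). A nonzero minor of size \<open>D + 1\<close> is then found by \<open>minor_nonzero_if_small_kernel\<close>.
\<close>

section \<open>Minors and rank\<close>

lemma minor_eq_det:
  assumes "I \<subseteq> {..<dim_row A}" "J \<subseteq> {..<dim_col A}" "card I = n" "card J = n"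
  shows "minor A I J = det (mat n n (\<lambda>(i, j). A $$ (pick I i, pick J j)))"
proof -
  have "{i. i < dim_row A \<and> i \<in> I} = I" "{j. j < dim_col A \<and> j \<in> J} = J"
    using assms(1,2) by auto
  then show ?thesis using assms(3,4) by (simp add: minor_def submatrix_def)
qed

lemma det_zero_row:
  assumes "k < n" and "\<And>j. j < n \<Longrightarrow> f k j = (0::'a::comm_ring_1)"
  shows "det (mat n n (\<lambda>(i, j). f i j)) = 0"
  by (subst laplace_expansion_row[of _ n k]) (use assms in auto)

text \<open>The rank bound in the form used for the vanishing statement: \<open>A = F G\<close> with inner dimension \<open>d\<close>. After
  padding both factors of the submatrix with zeros to square matrices, the second one has a zero row.\<close>

lemma minor_eq_0_if_factors:
  fixes A :: "'a::comm_ring_1 mat"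
  assumes fac: "\<And>a b. a < dim_row A \<Longrightarrow> b < dim_col A \<Longrightarrow> A $$ (a, b) = (\<Sum>h<d. F a h * G h b)"
    and I: "I \<subseteq> {..<dim_row A}" and J: "J \<subseteq> {..<dim_col A}"
    and card: "card I = n" "card J = n" and d: "d < n"
  shows "minor A I J = 0"
proof -
  let ?P = "mat n n (\<lambda>(i, h). if h < d then F (pick I i) h else 0)"
  let ?Q = "mat n n (\<lambda>(h, j). if h < d then G h (pick J j) else 0)"
  have "mat n n (\<lambda>(i, j). A $$ (pick I i, pick J j)) = ?P * ?Q"
  proof (rule eq_matI)
    fix i j assume "i < dim_row (?P * ?Q)" "j < dim_col (?P * ?Q)"
    then have ij: "i < n" "j < n" by auto
    have "pick I i < dim_row A" "pick J j < dim_col A"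
      using pick_in_set_le[of i I] pick_in_set_le[of j J] ij card I J by auto
    then have "A $$ (pick I i, pick J j) = (\<Sum>h<d. F (pick I i) h * G h (pick J j))"
      by (rule fac)
    also have "\<dots> = (\<Sum>h<n. (if h < d then F (pick I i) h else 0) * (if h < d then G h (pick J j) else 0))"
      using d by (intro sum.mono_neutral_cong_left) auto
    finally show "mat n n (\<lambda>(i, j). A $$ (pick I i, pick J j)) $$ (i, j) = (?P * ?Q) $$ (i, j)"
      using ij by (simp add: scalar_prod_def atLeast0LessThan)
  qed auto
  moreover have "det ?Q = 0"
    using det_zero_row[of d n "\<lambda>h j. if h < d then G h (pick J j) else 0"] d by simp
  ultimately show ?thesis
    using minor_eq_det[OF I J card] det_mult[of ?P n ?Q] by simp
qed

lemma underdetermined_system: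
  fixes M :: "nat \<Rightarrow> nat \<Rightarrow> 'a::field"
  assumes "d < n"
  shows "\<exists>x. (\<exists>b<n. x b \<noteq> 0) \<and> (\<forall>a<d. (\<Sum>b<n. M a b * x b) = 0)"
proof -
  let ?A = "mat n n (\<lambda>(a, b). if a < d then M a b else 0)"
  have "det ?A = 0"
    using det_zero_row[of d n "\<lambda>a b. if a < d then M a b else 0"] assms by simp
  then obtain v where v: "v \<in> carrier_vec n" "v \<noteq> 0\<^sub>v n" "?A *\<^sub>v v = 0\<^sub>v n"
    using det_0_iff_vec_prod_zero_field[of ?A n] by auto
  have "\<exists>b<n. v $ b \<noteq> 0" using v(1,2) by (metis eq_vecI carrier_vecD index_zero_vec)
  moreover have "(\<Sum>b<n. M a b * v $ b) = 0" if "a < d" for a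
  proof -
    have "(?A *\<^sub>v v) $ a = 0" using v(3) that assms by simp
    then show ?thesis using that assms v(1) by (simp add: scalar_prod_def atLeast0LessThan)
  qed
  ultimately show ?thesis by (intro exI[of _ "\<lambda>b. v $ b"]) auto
qed

text \<open>Expanding a bordered minor along its new column \<open>b\<close> gives a linear relation between the entries
  of column \<open>b\<close> whose coefficients do not depend on \<open>b\<close>; the coefficient of the new row is the old
  minor, so one can solve for that row.\<close>

lemma row_combination_if_bordered_minors_vanish:
  fixes A :: "nat \<Rightarrow> nat \<Rightarrow> 'a::field"
  assumes nz: "det (mat k k (\<lambda>(i, j). A (r i) (c j))) \<noteq> 0"
    and z: "\<And>b. b \<in> B \<Longrightarrow>
      det (mat (Suc k) (Suc k) (\<lambda>(i, j). A (if i < k then r i else a) (if j < k then c j else b))) = 0"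
  shows "\<exists>F. \<forall>b\<in>B. A a b = (\<Sum>h<k. F h * A (r h) b)"
proof -
  define M where "M b = mat (Suc k) (Suc k) (\<lambda>(i, j). A (if i < k then r i else a) (if j < k then c j else b))" for b
  have M: "M b \<in> carrier_mat (Suc k) (Suc k)" for b by (simp add: M_def)
  define C where "C h = cofactor (M 0) h k" for h
  \<comment> \<open>The cofactors along the last column do not see the entries of that column.\<close>
  have cof: "cofactor (M b) h k = C h" for b h
  proof -
    have "mat_delete (M b) h k = mat_delete (M 0) h k"
      by (rule eq_matI) (auto simp: M_def mat_delete_def)
    then show ?thesis by (simp add: C_def cofactor_def)
  qed
  have "mat_delete (M 0) k k = mat k k (\<lambda>(i, j). A (r i) (c j))"
    by (rule eq_matI) (auto simp: M_def mat_delete_def)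
  then have Ck: "C k = det (mat k k (\<lambda>(i, j). A (r i) (c j)))" by (simp add: C_def cofactor_def)
  have "A a b = (\<Sum>h<k. (- C h / C k) * A (r h) b)" if b: "b \<in> B" for b
  proof -
    have "0 = (\<Sum>h<Suc k. M b $$ (h, k) * cofactor (M b) h k)"
      using z[OF b] laplace_expansion_column[OF M, of k b] by (simp add: M_def)
    also have "\<dots> = (\<Sum>h<k. A (r h) b * C h) + A a b * C k"
      by (simp add: cof) (simp add: M_def)
    finally have "A a b * C k = - (\<Sum>h<k. A (r h) b * C h)"
      by (simp add: eq_neg_iff_add_eq_0 add.commute)
    moreover have "C k \<noteq> 0" using nz Ck by simp
    ultimately have "A a b = - (\<Sum>h<k. A (r h) b * C h) / C k"
      by (metis nonzero_eq_divide_eq)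
    then show ?thesis by (simp add: sum_negf sum_divide_distrib mult.commute)
  qed
  then show ?thesis by (intro exI[of _ "\<lambda>h. - C h / C k"]) blast
qed

text \<open>Minors are taken over sets of rows and columns in increasing order, whereas the induction below
  produces families of rows and columns in the order of their discovery. Sorting such a family changes
  a determinant only by a sign, and a repeated row is impossible if the determinant is nonzero.\<close>

lemma det_sort_rows:
  fixes f :: "nat \<Rightarrow> nat \<Rightarrow> 'a::comm_ring_1"
  assumes nz: "det (mat k k (\<lambda>(i, j). f (r i) j)) \<noteq> 0"
  shows "card (r ` {..<k}) = k"
    and "det (mat k k (\<lambda>(i, j). f (pick (r ` {..<k}) i) j)) \<noteq> 0"
proof -
  let ?I = "r ` {..<k}" and ?M = "mat k k (\<lambda>(i, j). f (r i) j)"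
  have inj: "inj_on r {..<k}"
  proof (rule inj_onI, rule ccontr)
    fix i j assume ij: "i \<in> {..<k}" "j \<in> {..<k}" "r i = r j" "i \<noteq> j"
    have "row ?M i = row ?M j" by (rule eq_vecI) (use ij in auto)
    then show False using det_identical_rows[of ?M k i j] ij nz by auto
  qed
  then show card: "card ?I = k" by (simp add: card_image)
  define p where "p i = (if i < k then card {a \<in> ?I. a < r i} else i)" for i
  have pick: "pick ?I (p i) = r i" if "i < k" for i
    using pick_card_in_set[of "r i" ?I] that by (simp add: p_def)
  have less: "p i < k" if "i < k" for i
  proof -
    have "{a \<in> ?I. a < r i} \<subset> ?I" using that by auto
    then show ?thesis using psubset_card_mono[of ?I] card that by (simp add: p_def)
  qed
  have "inj_on p {0..<k}"
    using pick inj by (metis (mono_tags, lifting) atLeastLessThan_iff inj_on_def lessThan_iff)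
  moreover have "p ` {0..<k} \<subseteq> {0..<k}" using less by auto
  ultimately have "bij_betw p {0..<k} {0..<k}"
    by (simp add: bij_betw_def endo_inj_surj)
  then have perm: "p permutes {0..<k}"
    by (rule bij_imp_permutes) (simp add: p_def)
  let ?B = "mat k k (\<lambda>(i, j). f (pick ?I i) j)"
  have "?M = mat k k (\<lambda>(i, j). ?B $$ (p i, j))"
    by (rule eq_matI) (auto simp: less pick)
  then have "det ?M = signof p * det ?B"
    using det_permute_rows[OF _ perm, of ?B] by simp
  then show "det ?B \<noteq> 0" using nz by auto
qed

lemma minor_nonzero_if_det_nonzero:
  fixes A :: "'a::comm_ring_1 mat"
  assumes nz: "det (mat k k (\<lambda>(i, j). A $$ (r i, c j))) \<noteq> 0"
    and r: "\<And>i. i < k \<Longrightarrow> r i < dim_row A" and c: "\<And>j. j < k \<Longrightarrow> c j < dim_col A"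
  shows "\<exists>I \<subseteq> {..<dim_row A}. \<exists>J \<subseteq> {..<dim_col A}. card I = k \<and> card J = k \<and> minor A I J \<noteq> 0"
proof -
  have tr: "det (mat k k (\<lambda>(i, j). g i j)) = det (mat k k (\<lambda>(i, j). g j i))" for g :: "nat \<Rightarrow> nat \<Rightarrow> 'a"
  proof -
    have "mat k k (\<lambda>(i, j). g i j) = transpose_mat (mat k k (\<lambda>(i, j). g j i))"
      by (rule eq_matI) auto
    then show ?thesis using det_transpose[of "mat k k (\<lambda>(i, j). g j i)" k] by simp
  qed
  let ?I = "r ` {..<k}" and ?J = "c ` {..<k}"
  note rows = det_sort_rows[of k "\<lambda>a j. A $$ (a, c j)" r, OF nz]
  have "det (mat k k (\<lambda>(j, i). A $$ (pick ?I i, c j))) \<noteq> 0"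
    using rows(2) by (subst tr)
  note cols = det_sort_rows[of k "\<lambda>b i. A $$ (pick ?I i, b)" c, OF this]
  have "det (mat k k (\<lambda>(i, j). A $$ (pick ?I i, pick ?J j))) \<noteq> 0"
    using cols(2) by (subst tr)
  then have "minor A ?I ?J \<noteq> 0"
    using minor_eq_det[OF _ _ rows(1) cols(1), of A] r c by (simp add: image_subset_iff)
  then show ?thesis using rows(1) cols(1) r c by (intro exI[of _ ?I] exI[of _ ?J] conjI) auto
qed

text \<open>The rank bound in the form used for non-vanishing: if \<open>s\<close> further linear conditions cut the kernel
  of \<open>A\<close> down to zero, then the rank is at least the number of columns minus \<open>s\<close>. The minor is grown one
  row and column at a time. As long as \<open>k + s\<close> is less than the number of columns, some nonzero \<open>x\<close> is
  killed by the \<open>k\<close> chosen rows and by all of \<open>L\<close>, hence is not killed by some row \<open>a\<close> of \<open>A\<close>; so row \<open>a\<close>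
  is not a combination of the chosen rows and some bordered minor through it is nonzero.\<close>

lemma minor_nonzero_if_small_kernel:
  fixes A :: "'a::field mat" and L :: "nat \<Rightarrow> nat \<Rightarrow> 'a"
  assumes ker: "\<And>x. (\<And>a. a < dim_row A \<Longrightarrow> (\<Sum>b<dim_col A. A $$ (a, b) * x b) = 0) \<Longrightarrow>
      (\<And>l. l < s \<Longrightarrow> (\<Sum>b<dim_col A. L l b * x b) = 0) \<Longrightarrow> (\<forall>b<dim_col A. x b = 0)"
    and k: "k + s \<le> dim_col A"
  shows "\<exists>I \<subseteq> {..<dim_row A}. \<exists>J \<subseteq> {..<dim_col A}. card I = k \<and> card J = k \<and> minor A I J \<noteq> 0"
proof -
  let ?n = "dim_col A"
  have "\<exists>r c. (\<forall>i<k. r i < dim_row A) \<and> (\<forall>j<k. c j < ?n) \<and>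
      det (mat k k (\<lambda>(i, j). A $$ (r i, c j))) \<noteq> 0"
    using k
  proof (induction k)
    case 0
    show ?case by (simp add: det_dim_zero)
  next
    case (Suc k)
    then obtain r c where r: "\<forall>i<k. r i < dim_row A" and c: "\<forall>j<k. c j < ?n"
      and nz: "det (mat k k (\<lambda>(i, j). A $$ (r i, c j))) \<noteq> 0" by auto
    obtain x where x: "\<exists>b<?n. x b \<noteq> 0"
      "\<forall>a<k+s. (\<Sum>b<?n. (if a < k then A $$ (r a, b) else L (a - k) b) * x b) = 0"
      using underdetermined_system[of "k + s" ?n "\<lambda>a b. if a < k then A $$ (r a, b) else L (a - k) b"]
        Suc.prems by auto
    have xr: "(\<Sum>b<?n. A $$ (r h, b) * x b) = 0" if "h < k" for h
      using x(2)[rule_format, of h] that by simp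
    have xL: "(\<Sum>b<?n. L l b * x b) = 0" if "l < s" for l
      using x(2)[rule_format, of "k + l"] that by simp
    obtain a where a: "a < dim_row A" "(\<Sum>b<?n. A $$ (a, b) * x b) \<noteq> 0"
      using ker[of x] xL x(1) by blast
    \<comment> \<open>Otherwise row \<open>a\<close> would be a combination of the chosen rows, all of which kill \<open>x\<close>.\<close>
    have "\<exists>b<?n. det (mat (Suc k) (Suc k)
        (\<lambda>(i, j). A $$ (if i < k then r i else a, if j < k then c j else b))) \<noteq> 0"
    proof (rule ccontr)
      assume "\<not> ?thesis"
      then obtain F where F: "\<forall>b\<in>{..<?n}. A $$ (a, b) = (\<Sum>h<k. F h * A $$ (r h, b))"
        using row_combination_if_bordered_minors_vanish[of k "\<lambda>a b. A $$ (a, b)" r c "{..<?n}" a] nz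
        by auto
      have "(\<Sum>b<?n. A $$ (a, b) * x b) = (\<Sum>b<?n. \<Sum>h<k. F h * (A $$ (r h, b) * x b))"
        using F by (intro sum.cong) (simp_all add: sum_distrib_right mult.assoc)
      also have "\<dots> = (\<Sum>h<k. F h * (\<Sum>b<?n. A $$ (r h, b) * x b))"
        by (subst sum.swap) (simp add: sum_distrib_left)
      also have "\<dots> = 0" by (simp add: xr)
      finally show False using a(2) by simp
    qed
    then obtain b where b: "b < ?n" "det (mat (Suc k) (Suc k)
        (\<lambda>(i, j). A $$ (if i < k then r i else a, if j < k then c j else b))) \<noteq> 0" by blast
    show ?case
      by (intro exI[of _ "\<lambda>i. if i < k then r i else a"] exI[of _ "\<lambda>j. if j < k then c j else b"])
        (use r c a b in auto)
  qed
  then show ?thesis using minor_nonzero_if_det_nonzero[of k A] by blast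
qed

section \<open>Multiplication by a vector in the exterior algebra\<close>

definition wedge_vec :: "(nat \<Rightarrow> 'a) \<Rightarrow> (nat set \<Rightarrow> 'a) \<Rightarrow> nat set \<Rightarrow> 'a::comm_ring_1" where
  "wedge_vec v x S = (\<Sum>q\<in>S. (- 1) ^ card {r \<in> S. r < q} * v q * x (S - {q}))"

lemma wedge_ext_of_vec:
  assumes S: "S \<subseteq> {..<m}" and v: "v \<in> carrier_vec m"
  shows "wedge (ext_of_vec v) x S = wedge_vec (\<lambda>i. v $ i) x S"
proof -
  have fin: "finite S" using S finite_subset by blast
  have single: "ext_of_vec v {q} = v $ q" if "q \<in> S" for q
  proof -
    have "ext_of_vec v {q} = (\<Sum>i<m. if i = q then v $ q else 0)"
      unfolding ext_of_vec_def using v by (intro sum.cong) (auto simp: ext_basis_def)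
    then show ?thesis using that S by auto
  qed
  have other: "ext_of_vec v A = 0" if "A \<subseteq> S" "A \<notin> (\<lambda>q. {q}) ` S" for A
    unfolding ext_of_vec_def using that by (intro sum.neutral) (auto simp: ext_basis_def)
  have inv: "card (inversions {q} (S - {q})) = card {r \<in> S. r < q}" if "q \<in> S" for q
  proof -
    have "inversions {q} (S - {q}) = {q} \<times> {r \<in> S. r < q}" by (auto simp: inversions_def)
    then show ?thesis by (simp add: card_cartesian_product)
  qed
  have "wedge (ext_of_vec v) x S = (\<Sum>A\<in>(\<lambda>q. {q}) ` S.
      (- 1) ^ card (inversions A (S - A)) * ext_of_vec v A * x (S - A))"
    unfolding wedge_def using fin other by (intro sum.mono_neutral_right) auto
  also have "\<dots> = (\<Sum>q\<in>S. (- 1) ^ card (inversions {q} (S - {q})) * ext_of_vec v {q} * x (S - {q}))"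
    by (subst sum.reindex) (auto simp: inj_on_def)
  finally show ?thesis
    unfolding wedge_vec_def by (simp add: single inv cong: sum.cong)
qed

text \<open>This is \<open>v \<and> v \<and> x = 0\<close>: the terms that take \<open>q\<close> and \<open>s\<close> out of \<open>S\<close> in the two possible orders carry
  opposite signs.\<close>

lemma wedge_vec_wedge_vec:
  assumes fin: "finite S"
  shows "wedge_vec v (wedge_vec v x) S = 0"
proof -
  let ?c = "\<lambda>S q. (- 1 :: 'a) ^ card {r \<in> S. r < q}"
  define g where "g q s = ?c S q * ?c (S - {q}) s * v q * v s * x (S - {q} - {s})" for q s
  have anti: "g s q = - g q s" if "q \<in> S" "s \<in> S" "s < q" for q s
  proof -
    have "{r \<in> S - {q}. r < s} = {r \<in> S. r < s}" using that by auto
    moreover have "{r \<in> S. r < q} = insert s {r \<in> S - {s}. r < q}" using that by auto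
    then have "card {r \<in> S. r < q} = Suc (card {r \<in> S - {s}. r < q})" using fin by simp
    moreover have "S - {q} - {s} = S - {s} - {q}" by auto
    ultimately show ?thesis by (simp add: g_def ac_simps)
  qed
  have "wedge_vec v (wedge_vec v x) S = (\<Sum>q\<in>S. \<Sum>s\<in>S - {q}. g q s)"
    unfolding wedge_vec_def g_def by (simp add: sum_distrib_left ac_simps)
  also have "\<dots> = (\<Sum>q\<in>S. \<Sum>s\<in>S. (if s < q then g q s else 0) + (if q < s then g q s else 0))"
  proof (rule sum.cong)
    fix q assume "q \<in> S"
    show "(\<Sum>s\<in>S - {q}. g q s) = (\<Sum>s\<in>S. (if s < q then g q s else 0) + (if q < s then g q s else 0))"
      using fin by (intro sum.mono_neutral_cong_left) auto
  qed simp
  also have "\<dots> = (\<Sum>q\<in>S. \<Sum>s\<in>S. if s < q then g q s else 0) + (\<Sum>q\<in>S. \<Sum>s\<in>S. if q < s then g q s else 0)"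
    by (simp add: sum.distrib)
  also have "(\<Sum>q\<in>S. \<Sum>s\<in>S. if q < s then g q s else 0) = (\<Sum>q\<in>S. \<Sum>s\<in>S. if s < q then g s q else 0)"
    by (rule sum.swap)
  also have "\<dots> = (\<Sum>q\<in>S. \<Sum>s\<in>S. - (if s < q then g q s else 0))"
    by (intro sum.cong) (auto simp: anti)
  finally show ?thesis by (simp add: sum_negf)
qed

lemma wedge_vec_expand:
  assumes fin: "finite \<U>" and S: "\<And>q. q \<in> S \<Longrightarrow> S - {q} \<in> \<U>"
  shows "wedge_vec v x S = (\<Sum>U\<in>\<U>. x U * wedge_vec v (ext_basis U) S)"
proof -
  have "x (S - {q}) = (\<Sum>U\<in>\<U>. x U * ext_basis U (S - {q}))" if "q \<in> S" for q
  proof -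
    have "(\<Sum>U\<in>\<U>. x U * ext_basis U (S - {q})) = (\<Sum>U\<in>\<U>. if U = S - {q} then x (S - {q}) else 0)"
      by (rule sum.cong) (auto simp: ext_basis_def)
    then show ?thesis using fin S[OF that] by simp
  qed
  then have "wedge_vec v x S =
      (\<Sum>q\<in>S. (- 1) ^ card {r \<in> S. r < q} * v q * (\<Sum>U\<in>\<U>. x U * ext_basis U (S - {q})))"
    unfolding wedge_vec_def by (intro sum.cong) auto
  also have "\<dots> = (\<Sum>q\<in>S. \<Sum>U\<in>\<U>. x U * ((- 1) ^ card {r \<in> S. r < q} * v q * ext_basis U (S - {q})))"
    unfolding sum_distrib_left by (simp add: ac_simps)
  also have "\<dots> = (\<Sum>U\<in>\<U>. x U * wedge_vec v (ext_basis U) S)"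
    unfolding wedge_vec_def by (subst sum.swap) (simp add: sum_distrib_left)
  finally show ?thesis .
qed

text \<open>The image of \<open>v \<and> _\<close> is spanned by the \<open>v \<and> e\<^sub>U\<close> with \<open>i \<notin> U\<close> when \<open>v i \<noteq> 0\<close>. For \<open>i \<in> R\<close>, expand
  \<open>0 = v \<and> (v \<and> e\<^bsub>R - {i}\<^esub>)\<close>: the coefficient of \<open>e\<^sub>R\<close> in the bracket is \<open>\<plusminus> v i\<close>, and every other basis
  vector occurring in the bracket avoids \<open>i\<close>.\<close>

lemma wedge_vec_column_combination:
  fixes v :: "nat \<Rightarrow> 'a::field"
  assumes vi: "v i \<noteq> 0" and R: "R \<subseteq> {..<m}" "card R = p"
  shows "\<exists>c. \<forall>S. S \<subseteq> {..<m} \<and> card S = Suc p \<longrightarrow>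
    wedge_vec v (ext_basis R) S = (\<Sum>U | U \<subseteq> {..<m} - {i} \<and> card U = p. c U * wedge_vec v (ext_basis U) S)"
proof -
  define V where "V = {U. U \<subseteq> {..<m} - {i} \<and> card U = p}"
  have finV: "finite V" unfolding V_def by (rule finite_subset[of _ "Pow {..<m}"]) auto
  have finR: "finite R" using R(1) finite_subset by blast
  have "\<exists>c. \<forall>S. S \<subseteq> {..<m} \<and> card S = Suc p \<longrightarrow>
    wedge_vec v (ext_basis R) S = (\<Sum>U\<in>V. c U * wedge_vec v (ext_basis U) S)"
  proof (cases "i \<in> R")
    case False
    then have "R \<in> V" using R by (auto simp: V_def)
    then have "wedge_vec v (ext_basis R) S = (\<Sum>U\<in>V. (if U = R then 1 else 0) * wedge_vec v (ext_basis U) S)" for S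
      using finV by (simp add: if_distrib[of "\<lambda>c. c * _"] cong: if_cong)
    then show ?thesis by (intro exI[of _ "\<lambda>U. if U = R then 1 else 0"]) blast
  next
    case True
    define y where "y = wedge_vec v (ext_basis (R - {i}))"
    define \<U> where "\<U> = {U. U \<subseteq> {..<m} \<and> card U = p}"
    have fin\<U>: "finite \<U>" unfolding \<U>_def by (rule finite_subset[of _ "Pow {..<m}"]) auto
    have yR: "y R \<noteq> 0"
    proof -
      have "y R = (\<Sum>q\<in>R. if q = i then (- 1) ^ card {r \<in> R. r < i} * v i else 0)"
        unfolding y_def wedge_vec_def using True by (intro sum.cong) (auto simp: ext_basis_def)
      then show ?thesis using True finR vi by simp
    qed
    have y0: "y U = 0" if "i \<in> U" "U \<noteq> R" for U
      unfolding y_def wedge_vec_def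
      by (intro sum.neutral) (use that True in \<open>auto simp: ext_basis_def\<close>)
    have "wedge_vec v (ext_basis R) S = (\<Sum>U\<in>V. (- y U / y R) * wedge_vec v (ext_basis U) S)"
      if S: "S \<subseteq> {..<m}" "card S = Suc p" for S
    proof -
      have finS: "finite S" using S(1) finite_subset by blast
      have "0 = wedge_vec v y S"
        unfolding y_def by (rule wedge_vec_wedge_vec[OF finS, symmetric])
      also have "\<dots> = (\<Sum>U\<in>\<U>. y U * wedge_vec v (ext_basis U) S)"
        by (rule wedge_vec_expand[OF fin\<U>]) (use S finS in \<open>auto simp: \<U>_def\<close>)
      \<comment> \<open>Of the subsets containing \<open>i\<close>, only \<open>R\<close> contributes.\<close>
      also have "\<dots> = (\<Sum>U\<in>insert R V. y U * wedge_vec v (ext_basis U) S)"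
        by (rule sum.mono_neutral_right[OF fin\<U>]) (use R y0 in \<open>auto simp: \<U>_def V_def\<close>)
      also have "\<dots> = y R * wedge_vec v (ext_basis R) S + (\<Sum>U\<in>V. y U * wedge_vec v (ext_basis U) S)"
        using finV True by (subst sum.insert) (auto simp: V_def)
      finally have "wedge_vec v (ext_basis R) S * y R = - (\<Sum>U\<in>V. y U * wedge_vec v (ext_basis U) S)"
        by (simp add: eq_neg_iff_add_eq_0 mult.commute)
      then have "wedge_vec v (ext_basis R) S = - (\<Sum>U\<in>V. y U * wedge_vec v (ext_basis U) S) / y R"
        using yR by (metis nonzero_eq_divide_eq)
      then show ?thesis by (simp add: sum_negf sum_divide_distrib)
    qed
    then show ?thesis by (intro exI[of _ "\<lambda>U. - y U / y R"]) blast
  qed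
  then show ?thesis unfolding V_def .
qed

lemma nth_subset_list:
  "b < m choose p \<Longrightarrow> subset_list m p ! b \<subseteq> {..<m} \<and> card (subset_list m p ! b) = p"
  using nth_mem[of b "subset_list m p"] subset_list(2,3)[of m p] by auto

lemma wedge_map_index:
  assumes "v \<in> carrier_vec m" "a < m choose Suc p" "b < m choose p"
  shows "wedge_map m p v $$ (a, b) =
    wedge_vec (\<lambda>i. v $ i) (ext_basis (subset_list m p ! b)) (subset_list m (Suc p) ! a)"
proof -
  have "subset_list m (Suc p) ! a \<subseteq> {..<m}" using nth_subset_list assms(2) by blast
  then show ?thesis
    using assms by (simp add: wedge_map_def ext_matrix_def wedge_ext_of_vec)
qed

text \<open>So \<open>v \<and> _\<close> has rank at most \<open>(m - 1) choose p\<close>, the number of \<open>p\<close>-subsets avoiding a position where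
  \<open>v\<close> is nonzero.\<close>

lemma wedge_map_factors:
  fixes v :: "'a::field vec"
  assumes v: "v \<in> carrier_vec m" and m: "0 < m"
  shows "\<exists>F G. \<forall>a < m choose Suc p. \<forall>b < m choose p.
    wedge_map m p v $$ (a, b) = (\<Sum>h < (m - 1) choose p. F a h * G h b)"
proof (cases "\<exists>i<m. v $ i \<noteq> 0")
  case False
  have "wedge_map m p v $$ (a, b) = 0" if "a < m choose Suc p" "b < m choose p" for a b
  proof -
    have "subset_list m (Suc p) ! a \<subseteq> {..<m}" using nth_subset_list that(1) by blast
    then show ?thesis
      unfolding wedge_map_index[OF v that] wedge_vec_def using False by (intro sum.neutral) auto
  qed
  then show ?thesis by (intro exI[of _ "\<lambda>_ _. 0"]) simp
next
  case True
  then obtain i where i: "i < m" "v $ i \<noteq> 0" by blast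
  let ?w = "wedge_vec (\<lambda>i. v $ i)"
  define V where "V = {U. U \<subseteq> {..<m} - {i} \<and> card U = p}"
  have "card V = (m - 1) choose p"
    unfolding V_def using i(1) by (subst n_subsets) auto
  moreover have "finite V" unfolding V_def by (rule finite_subset[of _ "Pow {..<m}"]) auto
  ultimately obtain e where e: "bij_betw e {..<(m - 1) choose p} V"
    using ex_bij_betw_nat_finite[of V] by (auto simp: atLeast0LessThan)
  have "\<forall>b. \<exists>c. b < m choose p \<longrightarrow> (\<forall>S. S \<subseteq> {..<m} \<and> card S = Suc p \<longrightarrow>
      ?w (ext_basis (subset_list m p ! b)) S = (\<Sum>U\<in>V. c U * ?w (ext_basis U) S))"
    using wedge_vec_column_combination[of "\<lambda>i. v $ i" i _ m p] i(2) nth_subset_list[of _ m p]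
    unfolding V_def by blast
  then obtain c where c: "\<And>b S. b < m choose p \<Longrightarrow> S \<subseteq> {..<m} \<Longrightarrow> card S = Suc p \<Longrightarrow>
      ?w (ext_basis (subset_list m p ! b)) S = (\<Sum>U\<in>V. c b U * ?w (ext_basis U) S)"
    by metis
  have "wedge_map m p v $$ (a, b) =
      (\<Sum>h < (m - 1) choose p. ?w (ext_basis (e h)) (subset_list m (Suc p) ! a) * c b (e h))"
    if a: "a < m choose Suc p" and b: "b < m choose p" for a b
  proof -
    have "wedge_map m p v $$ (a, b) = (\<Sum>U\<in>V. ?w (ext_basis U) (subset_list m (Suc p) ! a) * c b U)"
      using nth_subset_list[OF a] c[OF b] by (simp add: wedge_map_index[OF v a b] mult.commute)
    then show ?thesis by (subst sum.reindex_bij_betw[OF e])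
  qed
  then show ?thesis
    by (intro exI[of _ "\<lambda>a h. ?w (ext_basis (e h)) (subset_list m (Suc p) ! a)"]
        exI[of _ "\<lambda>h b. c b (e h)"]) blast
qed

section \<open>The flattening of a tensor of low border rank\<close>

lemma psi_L_index:
  assumes "a < (m choose Suc p) * m" "b < (m choose p) * m"
  shows "psi_L m p T $$ (a, b) =
    (\<Sum>i<m. wedge_map m p (unit_vec m i) $$ (a div m, b div m) * T i (a mod m) (b mod m))"
proof -
  have "0 < m" using assms by (cases m) auto
  then show ?thesis
    using assms by (simp add: psi_L_def kronecker_def slice_def wedge_map_def ext_matrix_def
        less_mult_imp_div_less)
qed

lemma sum_blocks: "(\<Sum>z<r * d. f z) = (\<Sum>l<r. \<Sum>h<d. f (l * d + h :: nat))"
proof -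
  have "sum f {l * d..<l * d + d} = (\<Sum>h<d. f (l * d + h))" for l
    using sum.shift_bounds_nat_ivl[of f 0 "l * d" d] by (simp add: atLeast0LessThan add.commute)
  then show ?thesis using sum.nat_group[of f d r] by simp
qed

text \<open>Each pure tensor \<open>s \<otimes> u \<otimes> w\<close> contributes the Kronecker product of \<open>s \<and> _\<close> with the rank one matrix
  \<open>u w\<^sup>T\<close>, so it adds \<open>d = (m - 1) choose p\<close> to the inner dimension. The summation index \<open>z\<close> encodes the pair
  of the pure tensor \<open>z div d\<close> and the inner index \<open>z mod d\<close>.\<close>

lemma psi_L_factors:
  fixes T :: "'a::field tensor3"
  assumes m: "0 < m" and P: "\<And>l. l < r \<Longrightarrow> P l \<in> pure_tensors m"
    and T: "T = (\<lambda>i j k. \<Sum>l<r. P l i j k)"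
  shows "\<exists>F G. \<forall>a < (m choose Suc p) * m. \<forall>b < (m choose p) * m.
    psi_L m p T $$ (a, b) = (\<Sum>z < r * ((m - 1) choose p). F a z * G z b)"
proof -
  let ?d = "(m - 1) choose p"
  have "\<forall>l. \<exists>s u w. l < r \<longrightarrow> P l = tensor_prod s u w \<and>
      s \<in> carrier_vec m \<and> u \<in> carrier_vec m \<and> w \<in> carrier_vec m"
    using P unfolding pure_tensors_def by blast
  then obtain s u w where suw: "\<And>l. l < r \<Longrightarrow> P l = tensor_prod (s l) (u l) (w l) \<and>
      s l \<in> carrier_vec m \<and> u l \<in> carrier_vec m \<and> w l \<in> carrier_vec m"
    by metis
  then have carrier: "s l \<in> carrier_vec m" if "l < r" for l using that by blast
  have entry: "P l i j k = s l $ i * u l $ j * w l $ k" if "l < r" "i < m" "j < m" "k < m" for l i j k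
    using suw[OF that(1)] that(2-4) by (auto simp: tensor_prod_def)
  have "\<forall>l. \<exists>F G. l < r \<longrightarrow> (\<forall>a < m choose Suc p. \<forall>b < m choose p.
      wedge_map m p (s l) $$ (a, b) = (\<Sum>h<?d. F a h * G h b))"
    using wedge_map_factors[of _ m p] suw m by blast
  then obtain F G where FG: "\<And>l a b. l < r \<Longrightarrow> a < m choose Suc p \<Longrightarrow> b < m choose p \<Longrightarrow>
      wedge_map m p (s l) $$ (a, b) = (\<Sum>h<?d. F l a h * G l h b)"
    by metis
  let ?X = "\<lambda>l. mat m m (\<lambda>(j, k). u l $ j * w l $ k)"
  have psi: "psi_L m p T = mat ((m choose Suc p) * m) ((m choose p) * m)
      (\<lambda>(a, b). \<Sum>l<r. kronecker (wedge_map m p (s l)) (?X l) $$ (a, b))"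
    by (rule psi_L_sum) (auto simp: carrier T entry mult.assoc intro!: sum.cong)
  let ?F = "\<lambda>a z. F (z div ?d) (a div m) (z mod ?d) * u (z div ?d) $ (a mod m)"
  let ?G = "\<lambda>z b. G (z div ?d) (z mod ?d) (b div m) * w (z div ?d) $ (b mod m)"
  have dm: "(l * ?d + h) div ?d = l" "(l * ?d + h) mod ?d = h" if "h < ?d" for l h
  proof -
    have "?d \<noteq> 0" using that by linarith
    then show "(l * ?d + h) div ?d = l" "(l * ?d + h) mod ?d = h" using that by simp_all
  qed
  have "psi_L m p T $$ (a, b) = (\<Sum>z < r * ?d. ?F a z * ?G z b)"
    if a: "a < (m choose Suc p) * m" and b: "b < (m choose p) * m" for a b
  proof -
    have ab: "a div m < m choose Suc p" "b div m < m choose p"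
      using a b by (auto simp: less_mult_imp_div_less)
    have "psi_L m p T $$ (a, b) =
        (\<Sum>l<r. wedge_map m p (s l) $$ (a div m, b div m) * (u l $ (a mod m) * w l $ (b mod m)))"
      using a b ab m by (simp add: psi kronecker_def wedge_map_def ext_matrix_def)
    also have "\<dots> = (\<Sum>l<r. \<Sum>h<?d. F l (a div m) h * G l h (b div m) * (u l $ (a mod m) * w l $ (b mod m)))"
      using FG ab by (intro sum.cong) (auto simp: sum_distrib_right)
    also have "\<dots> = (\<Sum>l<r. \<Sum>h<?d. ?F a (l * ?d + h) * ?G (l * ?d + h) b)"
      by (intro sum.cong refl, simp only: lessThan_iff dm) (simp only: ac_simps)
    finally show ?thesis by (simp only: sum_blocks)
  qed
  then show ?thesis by (intro exI[of _ ?F] exI[of _ ?G]) blast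
qed

text \<open>The least \<open>r\<close> in the definition of the tensor rank is attained because some decomposition exists:
  write \<open>T\<close> as the sum of the \<open>m\<^sup>2\<close> pure tensors \<open>e\<^sub>i \<otimes> e\<^sub>j \<otimes> T i j\<close>, the pair \<open>(i, j)\<close> being encoded as
  \<open>i * m + j\<close>.\<close>

lemma tensor_rank_decomposition:
  fixes T :: "'a::comm_ring_1 tensor3"
  assumes T: "T \<in> tensor_space m"
  shows "\<exists>P. (\<forall>l<tensor_rank m T. P l \<in> pure_tensors m) \<and>
    T = (\<lambda>i j k. \<Sum>l<tensor_rank m T. P l i j k)"
proof -
  let ?Q = "\<lambda>l. tensor_prod (unit_vec m (l div m)) (unit_vec m (l mod m)) (vec m (T (l div m) (l mod m)))"
  have "T i j k = (\<Sum>l<m * m. ?Q l i j k)" for i j k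
  proof (cases "i < m \<and> j < m \<and> k < m")
    case True
    then have "(\<Sum>l<m * m. ?Q l i j k) = (\<Sum>p<m. \<Sum>q<m. if q = j then if p = i then T i j k else 0 else 0)"
      unfolding sum_blocks by (intro sum.cong) (auto simp: tensor_prod_def)
    then show ?thesis using True by simp
  next
    case False
    then have "?Q l i j k = 0" for l by (auto simp: tensor_prod_def)
    moreover have "T i j k = 0" using T False unfolding tensor_space_def by blast
    ultimately show ?thesis by (simp only: sum.neutral_const)
  qed
  moreover have "?Q l \<in> pure_tensors m" for l
    unfolding pure_tensors_def mem_Collect_eq by (intro exI conjI refl) auto
  ultimately have "\<exists>P. (\<forall>l<m * m. P l \<in> pure_tensors m) \<and> T = (\<lambda>i j k. \<Sum>l<m * m. P l i j k)"
    by (intro exI[of _ ?Q]) blast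
  then show ?thesis unfolding tensor_rank_def by (rule LeastI)
qed

lemma polynomial_functions_sum:
  assumes "finite X" "\<And>x. x \<in> X \<Longrightarrow> f x \<in> polynomial_functions m"
  shows "(\<lambda>T. \<Sum>x\<in>X. f x T) \<in> polynomial_functions m"
  using assms by (induction X rule: finite_induct) (auto intro: polynomial_functions.intros)

lemma polynomial_functions_prod:
  assumes "finite X" "\<And>x. x \<in> X \<Longrightarrow> f x \<in> polynomial_functions m"
  shows "(\<lambda>T. \<Prod>x\<in>X. f x T) \<in> polynomial_functions m"
  using assms by (induction X rule: finite_induct) (auto intro: polynomial_functions.intros)

lemma polynomial_functions_det:
  assumes "\<And>i j. i < n \<Longrightarrow> j < n \<Longrightarrow> f i j \<in> polynomial_functions m"
  shows "(\<lambda>T. det (mat n n (\<lambda>(i, j). f i j T))) \<in> polynomial_functions m"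
proof -
  have "det (mat n n (\<lambda>(i, j). f i j T)) =
      (\<Sum>\<pi> | \<pi> permutes {0..<n}. signof \<pi> * (\<Prod>i=0..<n. f i (\<pi> i) T))" for T
    unfolding det_def by (auto intro!: sum.cong prod.cong simp: permutes_in_image)
  moreover have "(\<lambda>T. \<Sum>\<pi> | \<pi> permutes {0..<n}. signof \<pi> * (\<Prod>i=0..<n. f i (\<pi> i) T))
      \<in> polynomial_functions m"
    by (intro polynomial_functions_sum polynomial_functions.mult polynomial_functions.const
        polynomial_functions_prod assms)
      (auto simp: finite_permutations dest: permutes_in_image)
  ultimately show ?thesis by simp
qed

lemma polynomial_functions_minor_psi_L:
  assumes I: "I \<subseteq> {..<(m choose Suc p) * m}" and J: "J \<subseteq> {..<(m choose p) * m}"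
    and card: "card I = n" "card J = n"
  shows "(\<lambda>T. minor (psi_L m p T) I J) \<in> polynomial_functions m"
proof -
  have dims: "dim_row (psi_L m p T) = (m choose Suc p) * m" "dim_col (psi_L m p T) = (m choose p) * m"
    for T :: "'a tensor3" by (simp_all add: psi_L_def)
  have minor: "minor (psi_L m p T) I J = det (mat n n (\<lambda>(i, j). psi_L m p T $$ (pick I i, pick J j)))"
    for T :: "'a tensor3" by (rule minor_eq_det) (use I J card dims in auto)
  have "(\<lambda>T. psi_L m p T $$ (pick I i, pick J j)) \<in> polynomial_functions m" if "i < n" "j < n" for i j
  proof -
    have ij: "pick I i < (m choose Suc p) * m" "pick J j < (m choose p) * m"
      using pick_in_set_le[of i I] pick_in_set_le[of j J] that I J card by auto
    then have "0 < m" by (cases m) auto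
    then show ?thesis unfolding psi_L_index[OF ij]
      by (intro polynomial_functions_sum polynomial_functions.mult polynomial_functions.const
          polynomial_functions.coord) auto
  qed
  then show ?thesis unfolding minor by (rule polynomial_functions_det)
qed

lemma minor_psi_L_eq_0_if_low_rank:
  fixes T :: "'a::field tensor3"
  assumes T: "T \<in> rank_le_tensors m r" and m: "0 < m"
    and I: "I \<subseteq> {..<(m choose Suc p) * m}" and J: "J \<subseteq> {..<(m choose p) * m}"
    and card: "card I = n" "card J = n" and n: "r * ((m - 1) choose p) < n"
  shows "minor (psi_L m p T) I J = 0"
proof -
  let ?r = "tensor_rank m T"
  have Tr: "T \<in> tensor_space m" "?r \<le> r" using T by (auto simp: rank_le_tensors_def)
  obtain P where "\<forall>l<?r. P l \<in> pure_tensors m" "T = (\<lambda>i j k. \<Sum>l<?r. P l i j k)"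
    using tensor_rank_decomposition[OF Tr(1)] by blast
  then obtain F G where FG: "\<forall>a < (m choose Suc p) * m. \<forall>b < (m choose p) * m.
      psi_L m p T $$ (a, b) = (\<Sum>z < ?r * ((m - 1) choose p). F a z * G z b)"
    using psi_L_factors[OF m, of ?r P T p] by blast
  have d: "?r * ((m - 1) choose p) < n"
    using n mult_le_mono1[OF Tr(2), of "(m - 1) choose p"] by linarith
  show ?thesis
    by (rule minor_eq_0_if_factors[OF _ _ _ card d, of _ F G])
      (use FG I J in \<open>auto simp: psi_L_def\<close>)
qed

lemma polynomial_vanishes_on_zariski_closure:
  assumes f: "f \<in> polynomial_functions m" and S: "S \<subseteq> tensor_space m" "\<And>T. T \<in> S \<Longrightarrow> f T = 0"
    and T: "T \<in> zariski_closure m S"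
  shows "f T = 0"
proof -
  have "zariski_closed m {T \<in> tensor_space m. \<forall>g\<in>{f}. g T = 0}"
    unfolding zariski_closed_def using f by blast
  then show ?thesis using T S unfolding zariski_closure_def by auto
qed

lemma border_rank_closure:
  assumes "T \<in> tensor_space m"
  shows "T \<in> zariski_closure m (rank_le_tensors m (border_rank m T))"
proof -
  have "T \<in> zariski_closure m (rank_le_tensors m (tensor_rank m T))"
    using assms unfolding zariski_closure_def rank_le_tensors_def by blast
  then show ?thesis unfolding border_rank_def by (rule LeastI)
qed

lemma minor_psi_L_eq_0_if_low_border_rank:
  fixes T :: "'a::field tensor3"
  assumes T: "T \<in> tensor_space m" "border_rank m T \<le> r" and m: "0 < m"
    and I: "I \<subseteq> {..<(m choose Suc p) * m}" and J: "J \<subseteq> {..<(m choose p) * m}"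
    and card: "card I = n" "card J = n" and n: "r * ((m - 1) choose p) < n"
  shows "minor (psi_L m p T) I J = 0"
proof (rule polynomial_vanishes_on_zariski_closure[where f = "\<lambda>T. minor (psi_L m p T) I J"])
  show "(\<lambda>T. minor (psi_L m p T) I J) \<in> polynomial_functions m"
    by (rule polynomial_functions_minor_psi_L[OF I J card])
  show "T \<in> zariski_closure m (rank_le_tensors m (border_rank m T))"
    by (rule border_rank_closure[OF T(1)])
  show "rank_le_tensors m (border_rank m T) \<subseteq> tensor_space m"
    by (auto simp: rank_le_tensors_def)
  fix T' :: "'a tensor3" assume "T' \<in> rank_le_tensors m (border_rank m T)"
  then have "T' \<in> rank_le_tensors m r" using T(2) by (auto simp: rank_le_tensors_def)
  then show "minor (psi_L m p T') I J = 0"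
    by (rule minor_psi_L_eq_0_if_low_rank[OF _ m I J card n])
qed

section \<open>A tensor with a flattening of large rank\<close>

text \<open>This is \<open>\<Sum>\<^sub>i e\<^sub>i \<otimes> (\<nu>(2i) \<otimes> \<nu>(2i) + \<nu>(2i+1) \<otimes> \<nu>(2i+1))\<close> with \<open>\<nu>(t) = (1, t, \<dots>, t\<^bsup>m-1\<^esup>)\<close>: each basis
  vector of the first factor is paired with two points of the moment curve, and all \<open>2m\<close> points are
  distinct in characteristic zero.\<close>

definition vandermonde_tensor :: "nat \<Rightarrow> 'a::comm_ring_1 tensor3" where
  "vandermonde_tensor m = (\<lambda>i j k. if i < m \<and> j < m \<and> k < m
     then \<Sum>e<2. of_nat (2 * i + e) ^ j * of_nat (2 * i + e) ^ k else 0)"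

text \<open>At most \<open>n\<close> distinct points of the moment curve in \<open>K\<^sup>n\<close> are linearly independent: pair the relation
  with the polynomial vanishing at all of the points but \<open>t x\<close>.\<close>

lemma vandermonde_columns_independent:
  fixes t :: "'i \<Rightarrow> 'a::field"
  assumes X: "finite X" "card X \<le> n" and t: "inj_on t X"
    and z: "\<And>j. j < n \<Longrightarrow> (\<Sum>x\<in>X. c x * t x ^ j) = 0" and x: "x \<in> X"
  shows "c x = 0"
proof -
  \<comment> \<open>Its degree \<open>card X - 1\<close> is less than \<open>n\<close>, so pairing with the relation only uses the available powers.\<close>
  define q where "q = (\<Prod>y\<in>X - {x}. [:- t y, 1:])"
  have "degree q \<le> (\<Sum>y\<in>X - {x}. degree [:- t y, 1:])"
    unfolding q_def using degree_prod_sum_le[of "X - {x}" "\<lambda>y. [:- t y, 1:]"] X(1) by (simp add: o_def)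
  also have "\<dots> = card X - 1" using X(1) x by simp
  finally have deg: "degree q < n" using X x card_gt_0_iff[of X] by fastforce
  have "(\<Sum>y\<in>X. c y * poly q (t y)) = (\<Sum>i\<le>degree q. coeff q i * (\<Sum>y\<in>X. c y * t y ^ i))"
    unfolding poly_altdef by (simp add: sum_distrib_left) (subst sum.swap, simp add: ac_simps)
  also have "\<dots> = 0" using z deg by (intro sum.neutral) auto
  finally have "(\<Sum>y\<in>X. c y * poly q (t y)) = 0" .
  moreover have "poly q (t y) = 0" if "y \<in> X - {x}" for y
    using that X(1) by (auto simp: q_def poly_prod)
  then have "(\<Sum>y\<in>X. c y * poly q (t y)) = c x * poly q (t x)"
    using X(1) x by (subst sum.remove[of X x]) auto
  moreover have "poly q (t x) \<noteq> 0"
    using X(1) x t by (auto simp: q_def poly_prod inj_on_def)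
  ultimately show ?thesis by simp
qed

text \<open>A polynomial of degree less than \<open>n\<close> with \<open>n\<close> distinct roots is zero.\<close>

lemma vandermonde_rows_independent:
  fixes t :: "'i \<Rightarrow> 'a::field"
  assumes X: "finite X" "n \<le> card X" and t: "inj_on t X"
    and z: "\<And>x. x \<in> X \<Longrightarrow> (\<Sum>k<n. y k * t x ^ k) = 0" and k: "k < n"
  shows "y k = 0"
proof -
  define q where "q = (\<Sum>k<n. monom (y k) k)"
  have coeff: "coeff q i = (if i < n then y i else 0)" for i
    by (simp add: q_def coeff_sum)
  have "q = 0"
  proof (rule ccontr)
    assume nz: "q \<noteq> 0"
    have "degree q \<le> n - 1" by (rule degree_le) (auto simp: coeff)
    moreover have "t ` X \<subseteq> {a. poly q a = 0}"
      using z by (auto simp: q_def poly_sum poly_monom)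
    then have "card (t ` X) \<le> card {a. poly q a = 0}"
      by (rule card_mono[OF poly_roots_finite[OF nz]])
    then have "card X \<le> degree q"
      using card_image[OF t] card_poly_roots_bound[OF nz] by simp
    ultimately show False using X(2) k by simp
  qed
  then show ?thesis using coeff[of k] k by simp
qed

text \<open>Column \<open>b\<close> of the flattening stands for the pair of the subset number \<open>b div m\<close> and the
  coordinate \<open>b mod m\<close>. Here sums over columns become sums over such pairs; \<open>idx\<close> inverts the enumeration
  of the subsets.\<close>

lemma sum_over_subset_list_blocks:
  assumes idx: "\<And>b. b < m choose p \<Longrightarrow> idx (subset_list m p ! b) = b"
  shows "(\<Sum>b < (m choose p) * m. g (subset_list m p ! (b div m)) (b mod m) * x b) =
    (\<Sum>R | R \<subseteq> {..<m} \<and> card R = p. \<Sum>k<m. g R k * x (idx R * m + k))"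
proof -
  have "(\<Sum>b < (m choose p) * m. g (subset_list m p ! (b div m)) (b mod m) * x b) =
      (\<Sum>B < m choose p. \<Sum>k<m. g (subset_list m p ! B) k * x (idx (subset_list m p ! B) * m + k))"
    unfolding sum_blocks using idx by (intro sum.cong) auto
  also have "\<dots> = (\<Sum>R | R \<subseteq> {..<m} \<and> card R = p. \<Sum>k<m. g R k * x (idx R * m + k))"
    by (rule sum.reindex_bij_betw)
      (use subset_list[of m p] bij_betw_nth[of "subset_list m p"] in auto)
  finally show ?thesis .
qed

text \<open>The two points attached to \<open>q\<close> are the numbers \<open>\<tau>\<close> with \<open>\<tau> div 2 = q\<close>. Indexing by \<open>\<tau>\<close> turns a family of
  pairs of points into one family of distinct points.\<close>

lemma sum_div_2:
  assumes "finite S"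
  shows "(\<Sum>q\<in>S. \<Sum>e<2. f (2 * q + e)) = (\<Sum>\<tau> | \<tau> div 2 \<in> S. f (\<tau> :: nat))"
proof -
  have "(\<Sum>q\<in>S. \<Sum>e<2. f (2 * q + e)) = (\<Sum>(q, e)\<in>S \<times> {..<2}. f (2 * q + e))"
    by (rule sum.cartesian_product)
  also have "\<dots> = (\<Sum>\<tau> | \<tau> div 2 \<in> S. f \<tau>)"
    by (rule sum.reindex_bij_witness[of _ "\<lambda>\<tau>. (\<tau> div 2, \<tau> mod 2)" "\<lambda>(q, e). 2 * q + e"]) auto
  finally show ?thesis .
qed

lemma finite_card_div_2:
  fixes S :: "nat set"
  assumes "finite S"
  shows "finite {\<tau>. \<tau> div 2 \<in> S}" "card {\<tau>. \<tau> div 2 \<in> S} = 2 * card S"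
proof -
  have "bij_betw (\<lambda>(q, e). 2 * q + e) (S \<times> {..<2}) {\<tau>. \<tau> div 2 \<in> S}"
    by (rule bij_betw_byWitness[of _ "\<lambda>\<tau>. (\<tau> div 2, \<tau> mod 2)"]) auto
  then show "finite {\<tau>. \<tau> div 2 \<in> S}" "card {\<tau>. \<tau> div 2 \<in> S} = 2 * card S"
    using assms bij_betw_finite bij_betw_same_card[of _ "S \<times> {..<2::nat}"]
    by (fastforce, fastforce simp: card_cartesian_product)
qed

text \<open>Read the block of \<open>x\<close> at a \<open>p\<close>-subset \<open>R\<close> as a polynomial \<open>P\<^sub>R\<close> of degree less than \<open>m\<close>. Pairing it with
  \<open>\<nu>(\<tau>)\<close> evaluates it at \<open>\<tau>\<close>, so the block of the image at \<open>S\<close> is the combination of the vectors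
  \<open>\<nu>(\<tau>)\<close>, \<open>\<tau> div 2 \<in> S\<close>, with coefficients \<open>\<plusminus> P\<^bsub>S - {\<tau> div 2}\<^esub>(\<tau>)\<close>; its \<open>j\<close>-th coordinate is stated.\<close>

lemma psi_L_vandermonde_mult:
  fixes x :: "nat \<Rightarrow> 'a::comm_ring_1"
  assumes idx: "\<And>b. b < m choose p \<Longrightarrow> idx (subset_list m p ! b) = b"
    and A: "A < m choose Suc p" and j: "j < m"
  defines "S \<equiv> subset_list m (Suc p) ! A"
  shows "(\<Sum>b < (m choose p) * m. psi_L m p (vandermonde_tensor m) $$ (A * m + j, b) * x b) =
    (\<Sum>\<tau> | \<tau> div 2 \<in> S. (- 1) ^ card {r \<in> S. r < \<tau> div 2} *
       (\<Sum>k<m. x (idx (S - {\<tau> div 2}) * m + k) * of_nat \<tau> ^ k) * of_nat \<tau> ^ j)"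
proof -
  let ?T = "vandermonde_tensor m :: 'a tensor3"
  have S: "S \<subseteq> {..<m}" "card S = Suc p" using nth_subset_list[OF A] by (auto simp: S_def)
  have finS: "finite S" using S(1) finite_subset by blast
  have fin: "finite {R. R \<subseteq> {..<m} \<and> card R = p}" by (rule finite_subset[of _ "Pow {..<m}"]) auto
  let ?c = "\<lambda>q. (- 1 :: 'a) ^ card {r \<in> S. r < q}"
  let ?g = "\<lambda>R k. \<Sum>q\<in>S. if R = S - {q} then ?c q * ?T q j k else 0"
  have a: "A * m + j < (m choose Suc p) * m"
    using A j mult_le_mono1[of "Suc A" "m choose Suc p" m] by auto
  have "psi_L m p ?T $$ (A * m + j, b) = ?g (subset_list m p ! (b div m)) (b mod m)"
    if b: "b < (m choose p) * m" for b
  proof -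
    let ?R = "subset_list m p ! (b div m)"
    have "psi_L m p ?T $$ (A * m + j, b) =
        (\<Sum>i<m. wedge_vec (\<lambda>q. unit_vec m i $ q) (ext_basis ?R) S * ?T i j (b mod m))"
      unfolding psi_L_index[OF a b] using j A b
      by (intro sum.cong) (auto simp: wedge_map_index S_def less_mult_imp_div_less)
    also have "\<dots> = (\<Sum>i<m. \<Sum>q\<in>S. if q = i then ?c q * ext_basis ?R (S - {q}) * ?T q j (b mod m) else 0)"
      unfolding wedge_vec_def sum_distrib_right using S(1) by (intro sum.cong) auto
    also have "\<dots> = (\<Sum>q\<in>S. \<Sum>i<m. if q = i then ?c q * ext_basis ?R (S - {q}) * ?T q j (b mod m) else 0)"
      by (rule sum.swap)
    also have "\<dots> = ?g ?R (b mod m)"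
      using S(1) by (intro sum.cong) (auto simp: ext_basis_def)
    finally show ?thesis .
  qed
  then have "(\<Sum>b < (m choose p) * m. psi_L m p ?T $$ (A * m + j, b) * x b) =
      (\<Sum>b < (m choose p) * m. ?g (subset_list m p ! (b div m)) (b mod m) * x b)"
    by (intro sum.cong) auto
  also have "\<dots> = (\<Sum>R | R \<subseteq> {..<m} \<and> card R = p. \<Sum>k<m. ?g R k * x (idx R * m + k))"
    by (rule sum_over_subset_list_blocks[OF idx])
  also have "\<dots> = (\<Sum>R | R \<subseteq> {..<m} \<and> card R = p. \<Sum>q\<in>S.
      if R = S - {q} then \<Sum>k<m. ?c q * ?T q j k * x (idx (S - {q}) * m + k) else 0)"
    unfolding sum_distrib_right
    by (rule sum.cong[OF refl], subst sum.swap, intro sum.cong) auto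
  also have "\<dots> = (\<Sum>q\<in>S. \<Sum>R | R \<subseteq> {..<m} \<and> card R = p.
      if R = S - {q} then \<Sum>k<m. ?c q * ?T q j k * x (idx (S - {q}) * m + k) else 0)"
    by (rule sum.swap)
  also have "\<dots> = (\<Sum>q\<in>S. \<Sum>k<m. ?c q * ?T q j k * x (idx (S - {q}) * m + k))"
    using S finS by (intro sum.cong refl) (subst sum.delta[OF fin], auto)
  also have "\<dots> = (\<Sum>q\<in>S. \<Sum>k<m. \<Sum>e<2. ?c q * of_nat (2 * q + e) ^ j * of_nat (2 * q + e) ^ k *
      x (idx (S - {q}) * m + k))"
    using S(1) j by (intro sum.cong refl)
      (auto simp: vandermonde_tensor_def sum_distrib_left sum_distrib_right mult.assoc)
  also have "\<dots> = (\<Sum>q\<in>S. \<Sum>e<2. ?c q * (\<Sum>k<m. x (idx (S - {q}) * m + k) * of_nat (2 * q + e) ^ k) *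
      of_nat (2 * q + e) ^ j)"
    by (rule sum.cong[OF refl], subst sum.swap)
      (simp add: sum_distrib_left sum_distrib_right ac_simps)
  also have "\<dots> = (\<Sum>q\<in>S. \<Sum>e<2. (\<lambda>\<tau>. ?c (\<tau> div 2) *
      (\<Sum>k<m. x (idx (S - {\<tau> div 2}) * m + k) * of_nat \<tau> ^ k) * of_nat \<tau> ^ j) (2 * q + e))"
    by (intro sum.cong refl) auto
  also have "\<dots> = (\<Sum>\<tau> | \<tau> div 2 \<in> S. ?c (\<tau> div 2) *
      (\<Sum>k<m. x (idx (S - {\<tau> div 2}) * m + k) * of_nat \<tau> ^ k) * of_nat \<tau> ^ j)"
    by (rule sum_div_2[OF finS])
  finally show ?thesis .
qed

text \<open>Let \<open>x\<close> be in the kernel. For each \<open>S\<close> of size \<open>p + 1\<close> there is a linear relation between \<open>2p + 2 = m + 1\<close>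
  points of the moment curve in \<open>K\<^sup>m\<close>. Such relations form a line, so once the coefficient at a single
  point, here \<open>2 * Min S\<close>, is required to vanish, all coefficients vanish. Hence each \<open>P\<^sub>R\<close> vanishes at both
  points attached to each of the \<open>p + 1\<close> indices outside \<open>R\<close>, which are more roots than its degree allows.\<close>

lemma psi_L_vandermonde_kernel:
  fixes x :: "nat \<Rightarrow> 'a::field_char_0"
  assumes m: "m = 2 * p + 1"
    and idx: "\<And>b. b < m choose p \<Longrightarrow> idx (subset_list m p ! b) = b"
    and psi: "\<And>a. a < (m choose Suc p) * m \<Longrightarrow>
      (\<Sum>b < (m choose p) * m. psi_L m p (vandermonde_tensor m) $$ (a, b) * x b) = 0"
    and extra: "\<And>A. A < m choose Suc p \<Longrightarrow>
      let S = subset_list m (Suc p) ! A in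
      (\<Sum>k<m. x (idx (S - {Min S}) * m + k) * of_nat (2 * Min S) ^ k) = 0"
    and b: "b < (m choose p) * m"
  shows "x b = 0"
proof -
  define P where "P R t = (\<Sum>k<m. x (idx R * m + k) * t ^ k)" for R t
  have root: "P (S - {\<tau> div 2}) (of_nat \<tau>) = 0"
    if S: "S \<subseteq> {..<m}" "card S = Suc p" and \<tau>: "\<tau> div 2 \<in> S" for S \<tau>
  proof -
    have finS: "finite S" using S(1) finite_subset by blast
    obtain A where A: "A < m choose Suc p" "S = subset_list m (Suc p) ! A"
      using S subset_list(2,3)[of m "Suc p"] by (metis (mono_tags, lifting) in_set_conv_nth mem_Collect_eq)
    let ?X = "{\<tau>. \<tau> div 2 \<in> S}" and ?\<tau>0 = "2 * Min S"
    let ?c = "\<lambda>\<tau>. (- 1) ^ card {r \<in> S. r < \<tau> div 2} * P (S - {\<tau> div 2}) (of_nat \<tau>)"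
    have "S \<noteq> {}" using S(2) by auto
    then have \<tau>0: "?\<tau>0 \<in> ?X" using Min_in[OF finS] by simp
    have P0: "P (S - {Min S}) (of_nat ?\<tau>0) = 0"
      using extra[OF A(1)] by (simp add: A(2) P_def Let_def)
    note fin = finite_card_div_2[OF finS]
    have z: "(\<Sum>\<tau>\<in>?X - {?\<tau>0}. ?c \<tau> * of_nat \<tau> ^ j) = 0" if j: "j < m" for j
    proof -
      have lt: "A * m + j < (m choose Suc p) * m"
        using A(1) j mult_le_mono1[of "Suc A" "m choose Suc p" m] by auto
      have "(\<Sum>\<tau>\<in>?X. ?c \<tau> * of_nat \<tau> ^ j) = 0"
        unfolding A(2) P_def
        by (rule trans[OF psi_L_vandermonde_mult[where idx = idx and x = x, OF idx A(1) j, symmetric] psi[OF lt]])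
      then show ?thesis using P0 by (simp add: sum.remove[OF fin(1) \<tau>0])
    qed
    show ?thesis
    proof (cases "\<tau> = ?\<tau>0")
      case True
      then show ?thesis using P0 by simp
    next
      case False
      have "?c \<tau> = 0"
      proof (rule vandermonde_columns_independent[where X = "?X - {?\<tau>0}" and n = m and t = of_nat, OF _ _ _ z])
        show "finite (?X - {?\<tau>0})" using fin(1) by blast
        show "card (?X - {?\<tau>0}) \<le> m" using fin \<tau>0 S(2) m by simp
      qed (use \<tau> False in \<open>auto simp: inj_on_def\<close>)
      then show ?thesis by simp
    qed
  qed
  let ?B = "b div m" and ?R = "subset_list m p ! (b div m)"
  have B: "?B < m choose p" using b by (simp add: less_mult_imp_div_less)
  have R: "?R \<subseteq> {..<m}" "card ?R = p" using nth_subset_list[OF B] by auto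
  have finR: "finite ?R" using R(1) finite_subset by blast
  have "x (idx ?R * m + b mod m) = 0"
  proof (rule vandermonde_rows_independent[where y = "\<lambda>k. x (idx ?R * m + k)" and k = "b mod m"
        and X = "{\<tau>. \<tau> div 2 \<in> {..<m} - ?R}" and t = of_nat])
    have "card ({..<m} - ?R) = p + 1" using R finR m by (simp add: card_Diff_subset)
    then show "m \<le> card {\<tau>. \<tau> div 2 \<in> {..<m} - ?R}"
      using m by (subst finite_card_div_2(2)) auto
    show "finite {\<tau>. \<tau> div 2 \<in> {..<m} - ?R}" by (rule finite_card_div_2(1)) simp
    show "inj_on (of_nat :: nat \<Rightarrow> 'a) {\<tau>. \<tau> div 2 \<in> {..<m} - ?R}" by (auto simp: inj_on_def)
    show "b mod m < m" using m by simp
    fix \<tau> assume \<tau>: "\<tau> \<in> {\<tau>. \<tau> div 2 \<in> {..<m} - ?R}"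
    then have "P (insert (\<tau> div 2) ?R - {\<tau> div 2}) (of_nat \<tau>) = 0"
      using R finR by (intro root) auto
    then show "(\<Sum>k<m. x (idx ?R * m + k) * of_nat \<tau> ^ k) = 0"
      using \<tau> by (simp add: P_def)
  qed
  then show ?thesis by (simp add: idx[OF B])
qed

lemma minor_psi_L_vandermonde_nonzero:
  assumes m: "m = 2 * p + 1" and n: "n + (m choose Suc p) \<le> (m choose p) * m"
  shows "\<exists>I \<subseteq> {..<(m choose Suc p) * m}. \<exists>J \<subseteq> {..<(m choose p) * m}. card I = n \<and> card J = n \<and>
    minor (psi_L m p (vandermonde_tensor m :: 'a::field_char_0 tensor3)) I J \<noteq> 0"
proof -
  let ?A = "psi_L m p (vandermonde_tensor m :: 'a tensor3)"
  have dims: "dim_row ?A = (m choose Suc p) * m" "dim_col ?A = (m choose p) * m"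
    by (simp_all add: psi_L_def)
  define idx where "idx = the_inv_into {..<m choose p} ((!) (subset_list m p))"
  have idx: "idx (subset_list m p ! b) = b" if "b < m choose p" for b
    unfolding idx_def using that subset_list(1,3)[of m p]
    by (intro the_inv_into_f_f) (auto simp: inj_on_def nth_eq_iff_index_eq)
  let ?S = "\<lambda>l. subset_list m (Suc p) ! l"
  \<comment> \<open>The extra condition for the \<open>l\<close>-th set \<open>S\<close>: evaluate \<open>P\<^bsub>S - {Min S}\<^esub>\<close> at \<open>2 * Min S\<close>.\<close>
  let ?L = "\<lambda>l b. if subset_list m p ! (b div m) = ?S l - {Min (?S l)}
    then of_nat (2 * Min (?S l)) ^ (b mod m) else (0::'a)"
  have L: "(\<Sum>b < (m choose p) * m. ?L l b * x b) =
      (\<Sum>k<m. x (idx (?S l - {Min (?S l)}) * m + k) * of_nat (2 * Min (?S l)) ^ k)"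
    if l: "l < m choose Suc p" for l and x :: "nat \<Rightarrow> 'a"
  proof -
    let ?U = "?S l - {Min (?S l)}" and ?t = "of_nat (2 * Min (?S l)) :: 'a"
    have S: "?S l \<subseteq> {..<m}" "card (?S l) = Suc p" using nth_subset_list[OF l] by auto
    then have "finite (?S l)" "?S l \<noteq> {}" by (auto dest: finite_subset)
    then have U: "?U \<in> {R. R \<subseteq> {..<m} \<and> card R = p}"
      using S Min_in[of "?S l"] by auto
    have fin: "finite {R. R \<subseteq> {..<m} \<and> card R = p}" by (rule finite_subset[of _ "Pow {..<m}"]) auto
    have "(\<Sum>b < (m choose p) * m. ?L l b * x b) =
        (\<Sum>R | R \<subseteq> {..<m} \<and> card R = p. \<Sum>k<m. (if R = ?U then ?t ^ k else 0) * x (idx R * m + k))"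
      by (rule sum_over_subset_list_blocks[OF idx, of "\<lambda>R k. if R = ?U then ?t ^ k else 0"])
    also have "\<dots> = (\<Sum>R | R \<subseteq> {..<m} \<and> card R = p.
        if R = ?U then \<Sum>k<m. x (idx ?U * m + k) * ?t ^ k else 0)"
      by (intro sum.cong refl) (auto intro!: sum.cong sum.neutral)
    finally show ?thesis using U by (simp add: sum.delta[OF fin])
  qed
  have "\<forall>b < dim_col ?A. x b = 0"
    if psi: "\<And>a. a < dim_row ?A \<Longrightarrow> (\<Sum>b<dim_col ?A. ?A $$ (a, b) * x b) = 0"
      and extra: "\<And>l. l < m choose Suc p \<Longrightarrow> (\<Sum>b<dim_col ?A. ?L l b * x b) = 0" for x
  proof (intro allI impI, rule psi_L_vandermonde_kernel[OF m idx, where x = x])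
    fix a assume "a < (m choose Suc p) * m"
    then show "(\<Sum>b < (m choose p) * m. ?A $$ (a, b) * x b) = 0" by (rule psi[of a, unfolded dims])
  next
    fix l assume l: "l < m choose Suc p"
    show "let S = ?S l in (\<Sum>k<m. x (idx (S - {Min S}) * m + k) * of_nat (2 * Min S) ^ k) = 0"
      unfolding Let_def by (rule trans[OF L[OF l, symmetric] extra[OF l, unfolded dims]])
  next
    fix b assume "b < dim_col ?A"
    then show "b < (m choose p) * m" unfolding dims .
  qed auto
  from minor_nonzero_if_small_kernel[of ?A "m choose Suc p" ?L n, OF this] n
  show ?thesis unfolding dims by blast
qed

text \<open>By \<open>(p + 1) * ((2p + 1) choose p) = (2p + 1) * (2p choose p)\<close>, the two sides without the summand \<open>1\<close>, multiplied
  by \<open>p + 1\<close>, differ by exactly \<open>2 * (2p choose p)\<close>.\<close>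

lemma codimension_bound:
  assumes "p \<ge> 1"
  shows "((2 * p) choose p) * (4 * p - 2) + 1 \<le> 2 * p * ((2 * p + 1) choose p)"
proof -
  let ?C = "(2 * p) choose p" and ?N = "(2 * p + 1) choose p"
  have "?N = Suc (2 * p) choose Suc p" using binomial_symmetric[of p "2 * p + 1"] by simp
  then have N: "(p + 1) * ?N = (2 * p + 1) * ?C" using Suc_times_binomial[of p "2 * p"] by simp
  have "(p + 1) * (?C * (4 * p - 2)) < (p + 1) * (2 * p * ?N)"
  proof -
    obtain r where r: "p = Suc r" using assms by (cases p) auto
    have "(p + 1) * (2 * p * ?N) = 2 * p * ((2 * p + 1) * ?C)" using N by (metis mult.left_commute)
    also have "\<dots> = (p + 1) * (?C * (4 * p - 2)) + 2 * ?C" by (simp add: r algebra_simps)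
    finally show ?thesis by (simp add: zero_less_binomial)
  qed
  then have "?C * (4 * p - 2) < 2 * p * ?N" by (simp only: mult_less_cancel1)
  then show ?thesis by simp
qed

theorem theorem6p1:
  fixes p m N D :: nat
  assumes "p \<ge> 1"
    and "m = 2 * p + 1"
    and "N = (2 * p + 1) choose p"
    and "D = ((2 * p) choose p) * (2 * m - 4)"
  shows "(\<forall>I J. I \<subseteq> {..<N * m} \<and> J \<subseteq> {..<N * m} \<and> card I = D + 1 \<and> card J = D + 1 \<longrightarrow>
            (\<lambda>T :: 'a::field_char_0 tensor3. minor (psi_L m p T) I J) \<in> polynomial_functions m \<and>
            (\<forall>T :: 'a tensor3. T \<in> tensor_space m \<and> border_rank m T \<le> 2 * m - 4 \<longrightarrow>
               minor (psi_L m p T) I J = 0)) \<and>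
         (\<exists>I J. I \<subseteq> {..<N * m} \<and> J \<subseteq> {..<N * m} \<and> card I = D + 1 \<and> card J = D + 1 \<and>
            (\<exists>T :: 'a tensor3. T \<in> tensor_space m \<and> minor (psi_L m p T) I J \<noteq> 0))"
proof -
  have N: "m choose p = N" "m choose Suc p = N"
    using assms(2,3) binomial_symmetric[of p m] by simp_all
  have D: "(2 * m - 4) * ((m - 1) choose p) < D + 1" using assms(2,4) by simp
  have "D + 1 \<le> 2 * p * N" using codimension_bound[OF assms(1)] assms(2-4) by simp
  moreover have "N * m = 2 * p * N + N" by (simp add: assms(2))
  ultimately have small: "(D + 1) + (m choose Suc p) \<le> (m choose p) * m" unfolding N by linarith
  have "(vandermonde_tensor m :: 'a tensor3) \<in> tensor_space m"
    by (auto simp: vandermonde_tensor_def tensor_space_def)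
  then have "\<exists>I J. I \<subseteq> {..<N * m} \<and> J \<subseteq> {..<N * m} \<and> card I = D + 1 \<and> card J = D + 1 \<and>
      (\<exists>T :: 'a tensor3. T \<in> tensor_space m \<and> minor (psi_L m p T) I J \<noteq> 0)"
    using minor_psi_L_vandermonde_nonzero[OF assms(2) small, where 'a = 'a] unfolding N by blast
  moreover have "(\<lambda>T :: 'a tensor3. minor (psi_L m p T) I J) \<in> polynomial_functions m \<and>
      (\<forall>T :: 'a tensor3. T \<in> tensor_space m \<and> border_rank m T \<le> 2 * m - 4 \<longrightarrow>
        minor (psi_L m p T) I J = 0)"
    if IJ: "I \<subseteq> {..<N * m}" "J \<subseteq> {..<N * m}" "card I = D + 1" "card J = D + 1" for I J
  proof -
    have "0 < m" using assms(2) by simp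
    then show ?thesis
      using polynomial_functions_minor_psi_L[of I m p J "D + 1"]
        minor_psi_L_eq_0_if_low_border_rank[of _ m "2 * m - 4" I p J "D + 1"] IJ D
      unfolding N by blast
  qed
  ultimately show ?thesis by blast
qed

end
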